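(* Let $k$ be a field (of arbitrary characteristic) and let $R=k\llbracket x,y\rrbracket/(x^2y)$. Then $\tau_{MCM}(R)=(0)$.
   Context: All rings are commutative, unital, Noetherian and local. A maximal Cohen-Macaulay (MCM) module over a ring $R$ is a finitely generated (nonzero) $R$-module $M$ such that the length of the longest regular sequence on $M$ equals the Krull dimension of $R$; a sequence $x_1,\ldots,x_n$ in $R$ is regular on $M$ if $(x_1,\ldots,x_n)M\ne M$, $x_1$ is a non-zerodivisor on $M$, and $x_i$ is a non-zerodivisor on $M/(x_1,\ldots,x_{i-1})M$ for $2\le i\le n$. For an $R$-module $M$ and $R$-modules $A\subseteq B$, let $A_B^{\mathrm{cl}_M}=\{b\in B : x\otimes b\in \operatorname{im}(M\otimes_R A\to M\otimes_R B)\text{ for all }x\in M\}$. The test ideal of $R$ associated to $M$ is $\tau_M(R)=\bigcap_{A\subseteq B}(A:_R A_B^{\mathrm{cl}_M})$, the intersection over all pairs of $R$-modules $A\subseteq B$. By a known theorem, when $R$ is local and $M$ is finitely generated, $\tau_M(R)$ equals the trace ideal $\sum_{f\in\operatorname{Hom}_R(M,R)}f(M)$, and $\tau_M(R)$ denotes this common ideal. $\tau_{MCM}(R)=\bigcap_M \tau_M(R)$, the intersection over all isomorphism classes of maximal Cohen-Macaulay $R$-modules $M$. *)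

theory Defs
  imports
    "HOL-Algebra.Algebra"
    "HOL-Algebra.Free_Abelian_Groups"
    "HOL-Algebra.Algebraic_Closure_Type"
    "HOL-Computational_Algebra.Formal_Power_Series"
    "HOL-Library.Extended_Nat"
begin

section \<open>Submodules, homomorphisms, finite generation\<close>

definition gen_submodule ::
  "('r, 's) ring_scheme \<Rightarrow> ('r, 'm) module \<Rightarrow> 'm set \<Rightarrow> 'm set"
  where "gen_submodule R M S = \<Inter>{N. submodule N R M \<and> S \<subseteq> N}"

definition fin_gen :: "('r, 's) ring_scheme \<Rightarrow> ('r, 'm) module \<Rightarrow> bool"
  where "fin_gen R M \<longleftrightarrow>
    (\<exists>S. finite S \<and> S \<subseteq> carrier M \<and> gen_submodule R M S = carrier M)"

definition mod_hom ::
  "('r, 's) ring_scheme \<Rightarrow> ('r, 'm) module \<Rightarrow> ('r, 'n) module \<Rightarrow> ('m \<Rightarrow> 'n) set"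
  where "mod_hom R M N = {f. f \<in> carrier M \<rightarrow> carrier N
    \<and> (\<forall>x\<in>carrier M. \<forall>y\<in>carrier M. f (x \<oplus>\<^bsub>M\<^esub> y) = f x \<oplus>\<^bsub>N\<^esub> f y)
    \<and> (\<forall>r\<in>carrier R. \<forall>x\<in>carrier M. f (r \<odot>\<^bsub>M\<^esub> x) = r \<odot>\<^bsub>N\<^esub> f x)}"

definition self_module :: "('r, 's) ring_scheme \<Rightarrow> ('r, 'r) module"
  where "self_module R = \<lparr>carrier = carrier R, monoid.mult = (\<otimes>\<^bsub>R\<^esub>), one = \<one>\<^bsub>R\<^esub>,
    ring.zero = \<zero>\<^bsub>R\<^esub>, add = (\<oplus>\<^bsub>R\<^esub>), module.smult = (\<otimes>\<^bsub>R\<^esub>)\<rparr>"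

section \<open>Krull dimension, regular sequences, maximal Cohen-Macaulay modules\<close>

definition krull_dim :: "('r, 's) ring_scheme \<Rightarrow> enat"
  where "krull_dim R = Sup {enat n | n.
    \<exists>P. (\<forall>i\<le>n. primeideal (P i) R) \<and> (\<forall>i<n. P i \<subset> P (Suc i))}"

definition seq_mult ::
  "('r, 's) ring_scheme \<Rightarrow> ('r, 'm) module \<Rightarrow> 'r list \<Rightarrow> 'm set"
  where "seq_mult R M xs =
    gen_submodule R M {x \<odot>\<^bsub>M\<^esub> m | x m. x \<in> set xs \<and> m \<in> carrier M}"

text \<open>The last conjunct says, in terms of representatives, that each \<open>x\<^sub>i\<close> is a
  non-zerodivisor on the quotient of \<open>M\<close> by \<open>(x\<^sub>1, \<dots>, x\<^sub>i\<^sub>-\<^sub>1)M\<close>.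
  For the first element that submodule is zero.\<close>

definition regular_seq ::
  "('r, 's) ring_scheme \<Rightarrow> ('r, 'm) module \<Rightarrow> 'r list \<Rightarrow> bool"
  where "regular_seq R M xs \<longleftrightarrow>
    set xs \<subseteq> carrier R \<and> seq_mult R M xs \<noteq> carrier M \<and>
    (\<forall>i<length xs. \<forall>m\<in>carrier M.
      (xs ! i) \<odot>\<^bsub>M\<^esub> m \<in> seq_mult R M (take i xs) \<longrightarrow> m \<in> seq_mult R M (take i xs))"

definition module_depth :: "('r, 's) ring_scheme \<Rightarrow> ('r, 'm) module \<Rightarrow> enat"
  where "module_depth R M = Sup {enat (length xs) | xs. regular_seq R M xs}"

definition MCM :: "('r, 's) ring_scheme \<Rightarrow> ('r, 'm) module \<Rightarrow> bool"
  where "MCM R M \<longleftrightarrow> module R M \<and> fin_gen R M \<and> carrier M \<noteq> {\<zero>\<^bsub>M\<^esub>} \<and>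
    module_depth R M = krull_dim R"

section \<open>Tensor products and the closure operation of a module\<close>

text \<open>\<open>M \<otimes>\<^sub>R B\<close>, as an abelian group, is the free abelian group on the pairs modulo the
  usual relations.\<close>

definition tensor_free ::
  "('r, 'm) module \<Rightarrow> ('r, 'b) module \<Rightarrow> (('m \<times> 'b) \<Rightarrow>\<^sub>0 int) monoid"
  where "tensor_free M B = free_Abelian_group (carrier M \<times> carrier B)"

definition tensor_rel ::
  "('r, 's) ring_scheme \<Rightarrow> ('r, 'm) module \<Rightarrow> ('r, 'b) module \<Rightarrow> (('m \<times> 'b) \<Rightarrow>\<^sub>0 int) set"
  where "tensor_rel R M B = generate (tensor_free M B)
    ({frag_of (m \<oplus>\<^bsub>M\<^esub> m', b) - frag_of (m, b) - frag_of (m', b) | m m' b.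
        m \<in> carrier M \<and> m' \<in> carrier M \<and> b \<in> carrier B} \<union>
     {frag_of (m, b \<oplus>\<^bsub>B\<^esub> b') - frag_of (m, b) - frag_of (m, b') | m b b'.
        m \<in> carrier M \<and> b \<in> carrier B \<and> b' \<in> carrier B} \<union>
     {frag_of (r \<odot>\<^bsub>M\<^esub> m, b) - frag_of (m, r \<odot>\<^bsub>B\<^esub> b) | r m b.
        r \<in> carrier R \<and> m \<in> carrier M \<and> b \<in> carrier B})"

definition tensor ::
  "('r, 's) ring_scheme \<Rightarrow> ('r, 'm) module \<Rightarrow> ('r, 'b) module \<Rightarrow> (('m \<times> 'b) \<Rightarrow>\<^sub>0 int) set monoid"
  where "tensor R M B = tensor_free M B Mod tensor_rel R M B"

definition pure_tensor ::
  "('r, 's) ring_scheme \<Rightarrow> ('r, 'm) module \<Rightarrow> ('r, 'b) module \<Rightarrow> 'm \<Rightarrow> 'b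
    \<Rightarrow> (('m \<times> 'b) \<Rightarrow>\<^sub>0 int) set"
  where "pure_tensor R M B m b = tensor_rel R M B #>\<^bsub>tensor_free M B\<^esub> frag_of (m, b)"

text \<open>For a submodule \<open>A\<close> of \<open>B\<close>, the map \<open>M \<otimes> A \<rightarrow> M \<otimes> B\<close> induced by the inclusion: the
  class of \<open>z\<close> goes to the class of \<open>z\<close>, and since the relations for \<open>A\<close> are among those for
  \<open>B\<close>, this is multiplication of a coset by the relation subgroup for \<open>B\<close>.\<close>

definition tensor_incl ::
  "('r, 's) ring_scheme \<Rightarrow> ('r, 'm) module \<Rightarrow> ('r, 'b) module
    \<Rightarrow> (('m \<times> 'b) \<Rightarrow>\<^sub>0 int) set \<Rightarrow> (('m \<times> 'b) \<Rightarrow>\<^sub>0 int) set"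
  where "tensor_incl R M B T = tensor_rel R M B <#>\<^bsub>tensor_free M B\<^esub> T"

definition mod_closure ::
  "('r, 's) ring_scheme \<Rightarrow> ('r, 'm) module \<Rightarrow> ('r, 'b) module \<Rightarrow> 'b set \<Rightarrow> 'b set"
  where "mod_closure R M B A = {b \<in> carrier B. \<forall>x\<in>carrier M.
    pure_tensor R M B x b \<in> tensor_incl R M B ` carrier (tensor R M (B\<lparr>carrier := A\<rparr>))}"

definition colon_ideal ::
  "('r, 's) ring_scheme \<Rightarrow> ('r, 'b) module \<Rightarrow> 'b set \<Rightarrow> 'b set \<Rightarrow> 'r set"
  where "colon_ideal R B A C = {r \<in> carrier R. \<forall>c\<in>C. r \<odot>\<^bsub>B\<^esub> c \<in> A}"

section \<open>Test ideals and trace ideals\<close>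

text \<open>HOL cannot quantify over modules of all types inside a formula, so the intersections
  below range over the modules whose carrier is a set of the following type. It contains a copy
  of every finitely generated \<open>R\<close>-module (see \<open>fin_gen_module_in_univ\<close>), hence all isomorphism
  classes of maximal Cohen-Macaulay modules. For the ambient module \<open>B\<close> of a test ideal of a
  finitely generated \<open>M\<close>, finitely generated \<open>B\<close> suffice, because the finitely many equations
  expressing that \<open>x \<otimes> b\<close> lies in the image, for \<open>x\<close> in a finite generating set of \<open>M\<close>, only
  involve finitely many elements of \<open>B\<close>. In any case a smaller range of modules
  can only enlarge the intersections, so that their vanishing is the stronger assertion.\<close>

type_synonym 'r module_univ = "(nat \<Rightarrow> 'r) set"

definition test_ideal :: "('r, 's) ring_scheme \<Rightarrow> ('r, 'm) module \<Rightarrow> 'r set"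
  where "test_ideal R M =
    \<Inter>{colon_ideal R B A (mod_closure R M B A) | (B :: ('r, 'r module_univ) module) A.
        module R B \<and> submodule A R B}"

definition trace_ideal :: "('r, 's) ring_scheme \<Rightarrow> ('r, 'm) module \<Rightarrow> 'r set"
  where "trace_ideal R M = genideal R (\<Union>f\<in>mod_hom R M (self_module R). f ` carrier M)"

text \<open>For finitely generated modules over a Noetherian local ring the two ideals above
  coincide, but this is a theorem, so there is one version of the intersection for each.\<close>

definition tau_MCM :: "('r, 's) ring_scheme \<Rightarrow> 'r set"
  where "tau_MCM R = carrier R \<inter> \<Inter>{test_ideal R M | M :: ('r, 'r module_univ) module. MCM R M}"

definition trace_MCM :: "('r, 's) ring_scheme \<Rightarrow> 'r set"
  where "trace_MCM R = carrier R \<inter> \<Inter>{trace_ideal R M | M :: ('r, 'r module_univ) module. MCM R M}"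

lemma gen_submodule_subset_combinations:
  fixes R :: "('r, 's) ring_scheme" and M :: "('r, 'm) module"
  assumes M: "module R M" and e: "e \<in> {..<n::nat} \<rightarrow> carrier M"
  shows "gen_submodule R M (e ` {..<n}) \<subseteq>
    {finsum M (\<lambda>i. c i \<odot>\<^bsub>M\<^esub> e i) {..<n} | c. c \<in> {..<n} \<rightarrow> carrier R}" (is "_ \<subseteq> ?T")
proof -
  interpret module R M by (rule M)
  have ei: "\<And>i. i < n \<Longrightarrow> e i \<in> carrier M" using e by auto
  have "submodule ?T R M"
  proof (rule submoduleI)
    show "?T \<subseteq> carrier M" using ei by (auto intro!: M.finsum_closed simp: Pi_iff)
    have "finsum M (\<lambda>i. \<zero>\<^bsub>R\<^esub> \<odot>\<^bsub>M\<^esub> e i) {..<n} = \<zero>\<^bsub>M\<^esub>"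
      using ei by (intro M.add.finprod_one_eqI) auto
    then show "\<zero>\<^bsub>M\<^esub> \<in> ?T" by (intro CollectI exI[of _ "\<lambda>_. \<zero>\<^bsub>R\<^esub>"]) simp
    have smult: "r \<odot>\<^bsub>M\<^esub> x \<in> ?T" if r: "r \<in> carrier R" and x: "x \<in> ?T" for r x
    proof -
      obtain c where c: "c \<in> {..<n} \<rightarrow> carrier R"
        and xc: "x = finsum M (\<lambda>i. c i \<odot>\<^bsub>M\<^esub> e i) {..<n}" using x by blast
      have ci: "\<And>i. i < n \<Longrightarrow> c i \<in> carrier R" using c by auto
      have "r \<odot>\<^bsub>M\<^esub> x = finsum M (\<lambda>i. r \<odot>\<^bsub>M\<^esub> (c i \<odot>\<^bsub>M\<^esub> e i)) {..<n}"
        unfolding xc using r ci ei by (intro finsum_smult_ldistr) auto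
      also have "\<dots> = finsum M (\<lambda>i. (r \<otimes>\<^bsub>R\<^esub> c i) \<odot>\<^bsub>M\<^esub> e i) {..<n}"
        using r ci ei by (intro M.finsum_cong') (auto simp: smult_assoc1)
      finally show ?thesis using r ci by (intro CollectI exI[of _ "\<lambda>i. r \<otimes>\<^bsub>R\<^esub> c i"]) simp
    qed
    then show "\<And>r x. r \<in> carrier R \<Longrightarrow> x \<in> ?T \<Longrightarrow> r \<odot>\<^bsub>M\<^esub> x \<in> ?T" .
    show "\<ominus>\<^bsub>M\<^esub> x \<in> ?T" if x: "x \<in> ?T" for x
    proof -
      have "x \<in> carrier M" using x \<open>?T \<subseteq> carrier M\<close> by blast
      then have "\<ominus>\<^bsub>M\<^esub> x = (\<ominus>\<^bsub>R\<^esub> \<one>\<^bsub>R\<^esub>) \<odot>\<^bsub>M\<^esub> x" by (simp add: smult_l_minus)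
      then show ?thesis using smult[OF R.a_inv_closed[OF R.one_closed] x] by (simp only:)
    qed
    show "x \<oplus>\<^bsub>M\<^esub> y \<in> ?T" if x: "x \<in> ?T" and y: "y \<in> ?T" for x y
    proof -
      obtain c where c: "c \<in> {..<n} \<rightarrow> carrier R"
        and xc: "x = finsum M (\<lambda>i. c i \<odot>\<^bsub>M\<^esub> e i) {..<n}" using x by blast
      obtain d where d: "d \<in> {..<n} \<rightarrow> carrier R"
        and yd: "y = finsum M (\<lambda>i. d i \<odot>\<^bsub>M\<^esub> e i) {..<n}" using y by blast
      have ci: "\<And>i. i < n \<Longrightarrow> c i \<in> carrier R" "\<And>i. i < n \<Longrightarrow> d i \<in> carrier R"
        using c d by auto
      have "x \<oplus>\<^bsub>M\<^esub> y = finsum M (\<lambda>i. c i \<odot>\<^bsub>M\<^esub> e i \<oplus>\<^bsub>M\<^esub> d i \<odot>\<^bsub>M\<^esub> e i) {..<n}"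
        unfolding xc yd using ci ei by (intro M.finsum_addf[symmetric]) auto
      also have "\<dots> = finsum M (\<lambda>i. (c i \<oplus>\<^bsub>R\<^esub> d i) \<odot>\<^bsub>M\<^esub> e i) {..<n}"
        using ci ei by (intro M.finsum_cong') (auto simp: smult_l_distr)
      finally show ?thesis using ci by (intro CollectI exI[of _ "\<lambda>i. c i \<oplus>\<^bsub>R\<^esub> d i"]) simp
    qed
  qed
  moreover have "e ` {..<n} \<subseteq> ?T"
  proof (rule image_subsetI)
    fix j assume j: "j \<in> {..<n}"
    let ?c = "\<lambda>i. if j = i then \<one>\<^bsub>R\<^esub> else \<zero>\<^bsub>R\<^esub>"
    have "finsum M (\<lambda>i. ?c i \<odot>\<^bsub>M\<^esub> e i) {..<n} = finsum M (\<lambda>i. if j = i then e i else \<zero>\<^bsub>M\<^esub>) {..<n}"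
      using ei by (intro M.finsum_cong') auto
    also have "\<dots> = e j" using j ei by (intro M.finsum_singleton) auto
    finally show "e j \<in> ?T" by (intro CollectI exI[of _ ?c]) simp
  qed
  ultimately show ?thesis unfolding gen_submodule_def by blast
qed

lemma fin_gen_module_in_univ:
  fixes R :: "('r, 's) ring_scheme" and M :: "('r, 'm) module"
  assumes M: "module R M" and fg: "fin_gen R M"
  shows "\<exists>(N :: ('r, 'r module_univ) module) \<phi>. module R N \<and>
    \<phi> \<in> mod_hom R M N \<and> bij_betw \<phi> (carrier M) (carrier N)"
proof -
  interpret module R M by (rule M)
  obtain S where S: "finite S" "S \<subseteq> carrier M" "gen_submodule R M S = carrier M"
    using fg unfolding fin_gen_def by blast
  obtain e and n :: nat where e: "S = e ` {i. i < n}"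
    using finite_imp_nat_seg_image_inj_on[OF S(1)] by blast
  then have e': "S = e ` {..<n}" by (simp add: lessThan_def)
  have "e \<in> {..<n} \<rightarrow> carrier M" using e' S(2) by auto
  then have comb: "\<exists>c. c \<in> {..<n} \<rightarrow> carrier R \<and> m = finsum M (\<lambda>i. c i \<odot>\<^bsub>M\<^esub> e i) {..<n}"
    if "m \<in> carrier M" for m
    using gen_submodule_subset_combinations[OF M, of e n] S(3) e' that by blast
  define \<phi> where "\<phi> m = {c. c \<in> {..<n} \<rightarrow> carrier R \<and> m = finsum M (\<lambda>i. c i \<odot>\<^bsub>M\<^esub> e i) {..<n}}" for m
  have inj: "inj_on \<phi> (carrier M)"
  proof (rule inj_onI)
    fix x y assume "x \<in> carrier M" "y \<in> carrier M" "\<phi> x = \<phi> y"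
    moreover obtain c where "c \<in> \<phi> x" using comb[OF \<open>x \<in> carrier M\<close>] unfolding \<phi>_def by blast
    ultimately show "x = y" unfolding \<phi>_def by auto
  qed
  define \<psi> where "\<psi> = inv_into (carrier M) \<phi>"
  have \<psi>\<phi>: "\<psi> (\<phi> m) = m" if "m \<in> carrier M" for m
    unfolding \<psi>_def using inj that by simp
  define N :: "('r, 'r module_univ) module" where
    "N = \<lparr>carrier = \<phi> ` carrier M, monoid.mult = \<lambda>_ _. {}, one = {}, ring.zero = \<phi> \<zero>\<^bsub>M\<^esub>,
      add = \<lambda>u v. \<phi> (\<psi> u \<oplus>\<^bsub>M\<^esub> \<psi> v), module.smult = \<lambda>r u. \<phi> (r \<odot>\<^bsub>M\<^esub> \<psi> u)\<rparr>"
  have "module R N"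
  proof (rule moduleI)
    show "cring R" by (rule R.is_cring)
    show "abelian_group N"
    proof (rule abelian_groupI)
      fix x assume "x \<in> carrier N"
      then obtain m where m: "m \<in> carrier M" "x = \<phi> m" unfolding N_def by auto
      then show "\<exists>y\<in>carrier N. y \<oplus>\<^bsub>N\<^esub> x = \<zero>\<^bsub>N\<^esub>"
        by (auto simp: N_def \<psi>\<phi> M.l_neg intro!: bexI[of _ "\<ominus>\<^bsub>M\<^esub> m"])
    qed (auto simp: N_def \<psi>\<phi> M.a_ac)
  qed (auto simp: N_def \<psi>\<phi> smult_l_distr smult_r_distr smult_assoc1)
  moreover have "\<phi> \<in> mod_hom R M N"
    unfolding mod_hom_def N_def by (auto simp: \<psi>\<phi>)
  moreover have "bij_betw \<phi> (carrier M) (carrier N)"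
    unfolding bij_betw_def N_def using inj by simp
  ultimately show ?thesis by blast
qed

section \<open>Power series in two variables\<close>

text \<open>\<open>k\<lbrakk>x, y\<rbrakk>\<close> is taken as \<open>k\<lbrakk>x\<rbrakk>\<lbrakk>y\<rbrakk>\<close>: the variable \<open>x\<close> is the inner one.\<close>

definition fps2_ring :: "('k::field) fps fps ring"
  where "fps2_ring = ring_of_type_algebra"

definition X_var :: "('k::field) fps fps"
  where "X_var = fps_const fps_X"

definition Y_var :: "('k::field) fps fps"
  where "Y_var = fps_X"

end

theory Submission
  imports Defs
begin

text \<open>Two modules already force the intersections down to zero: \<open>R/(x)\<close> and \<open>R/(y)\<close>, which are power
  series rings in one variable, namely the coordinate rings of the two lines that make up the
  curve \<open>x\<^sup>2y = 0\<close>.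

  If \<open>a \<in> R\<close> kills a module \<open>M\<close>, then \<open>a f(m) = f(a m) = 0\<close> for every \<open>f : M \<rightarrow> R\<close>, so the trace ideal
  of \<open>M\<close> lies in the annihilator of \<open>a\<close> (\<open>trace_ideal_annihilates\<close>). The test ideal lies there too
  (\<open>test_ideal_annihilates\<close>): in \<open>B = R\<close> the closure of \<open>A = 0\<close> contains \<open>a\<close>, because
  \<open>m \<otimes> a = a m \<otimes> 1 = 0\<close>. Hence an element \<open>r\<close> of either intersection satisfies \<open>r x = 0 = r y\<close>.
  Lift \<open>r\<close> to a power series \<open>f\<close>: as \<open>x\<^sup>2y\<close> divides \<open>x f\<close> and \<open>y f\<close>, both \<open>y\<close> and \<open>x\<^sup>2\<close> divide \<open>f\<close>, so
  \<open>x\<^sup>2y\<close> divides \<open>f\<close> (\<open>X2Y_dvd_if_dvd_mult_vars\<close>) and \<open>r = 0\<close>.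

  The two modules must also be maximal Cohen-Macaulay, that is, have depth equal to the dimension of
  \<open>R\<close>. Everything needed about them follows from a surjection of \<open>R\<close> onto \<open>k\<lbrakk>t\<rbrakk>\<close>, the situation of
  the locale \<open>branch\<close>. Over the kernel of such a surjection lie only the two primes of \<open>k\<lbrakk>t\<rbrakk>\<close>, and
  each prime of \<open>R\<close> contains \<open>x\<close> or \<open>y\<close>, so \<open>R\<close> has dimension 1 (\<open>krull_dim_eq_one\<close>). The \<open>R\<close>-module
  \<open>k\<lbrakk>t\<rbrakk>\<close> has depth 1 (\<open>module_depth_eq_one\<close>): a preimage of \<open>t\<close> is regular on it, and two nonunits
  of \<open>k\<lbrakk>t\<rbrakk>\<close> never form a regular sequence.\<close>

section \<open>Elements that annihilate a module\<close>

lemma (in module) zero_submodule: "submodule {\<zero>\<^bsub>M\<^esub>} R M"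
  by (rule submoduleI) auto

lemma (in module) smult_image_submodule:
  assumes a: "a \<in> carrier R"
  shows "submodule ((\<lambda>m. a \<odot>\<^bsub>M\<^esub> m) ` carrier M) R M"
proof (rule submoduleI)
  show "(\<lambda>m. a \<odot>\<^bsub>M\<^esub> m) ` carrier M \<subseteq> carrier M" using a by auto
  show "\<zero>\<^bsub>M\<^esub> \<in> (\<lambda>m. a \<odot>\<^bsub>M\<^esub> m) ` carrier M" using a by (auto intro!: image_eqI[of _ _ "\<zero>\<^bsub>M\<^esub>"])
next
  fix x assume "x \<in> (\<lambda>m. a \<odot>\<^bsub>M\<^esub> m) ` carrier M"
  then obtain m where "m \<in> carrier M" "x = a \<odot>\<^bsub>M\<^esub> m" by blast
  then show "\<ominus>\<^bsub>M\<^esub> x \<in> (\<lambda>m. a \<odot>\<^bsub>M\<^esub> m) ` carrier M"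
    using a by (auto intro!: image_eqI[of _ _ "\<ominus>\<^bsub>M\<^esub> m"] simp: smult_r_minus)
next
  fix x y assume "x \<in> (\<lambda>m. a \<odot>\<^bsub>M\<^esub> m) ` carrier M" "y \<in> (\<lambda>m. a \<odot>\<^bsub>M\<^esub> m) ` carrier M"
  then obtain m n where "m \<in> carrier M" "x = a \<odot>\<^bsub>M\<^esub> m" "n \<in> carrier M" "y = a \<odot>\<^bsub>M\<^esub> n" by blast
  then show "x \<oplus>\<^bsub>M\<^esub> y \<in> (\<lambda>m. a \<odot>\<^bsub>M\<^esub> m) ` carrier M"
    using a by (auto intro!: image_eqI[of _ _ "m \<oplus>\<^bsub>M\<^esub> n"] simp: smult_r_distr)
next
  fix r x assume r: "r \<in> carrier R" and "x \<in> (\<lambda>m. a \<odot>\<^bsub>M\<^esub> m) ` carrier M"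
  then obtain m where "m \<in> carrier M" "x = a \<odot>\<^bsub>M\<^esub> m" by blast
  then show "r \<odot>\<^bsub>M\<^esub> x \<in> (\<lambda>m. a \<odot>\<^bsub>M\<^esub> m) ` carrier M"
    using a r by (auto intro!: image_eqI[of _ _ "r \<odot>\<^bsub>M\<^esub> m"] simp: R.m_comm simp flip: smult_assoc1)
qed

lemma (in cring) annihilator_ideal:
  assumes "a \<in> carrier R"
  shows "ideal {r \<in> carrier R. r \<otimes> a = \<zero>} R"
proof (rule idealI)
  show "subgroup {r \<in> carrier R. r \<otimes> a = \<zero>} (add_monoid R)"
    by (rule subgroup.intro)
      (use assms in \<open>auto simp: l_distr l_minus simp flip: a_inv_def\<close>)
  fix r x assume r: "r \<in> {r \<in> carrier R. r \<otimes> a = \<zero>}" and x: "x \<in> carrier R"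
  then show "x \<otimes> r \<in> {r \<in> carrier R. r \<otimes> a = \<zero>}" using assms by (simp add: m_assoc)
  then show "r \<otimes> x \<in> {r \<in> carrier R. r \<otimes> a = \<zero>}" using r x by (simp add: m_comm)
qed (rule ring_axioms)

text \<open>A homomorphism \<open>f : M \<rightarrow> R\<close> satisfies \<open>a f(m) = f(a m) = 0\<close>, and the annihilator of \<open>a\<close> is an ideal.\<close>

lemma trace_ideal_annihilates:
  fixes R :: "('r, 's) ring_scheme" and M :: "('r, 'm) module"
  assumes M: "module R M" and a: "a \<in> carrier R"
    and aM: "\<And>m. m \<in> carrier M \<Longrightarrow> a \<odot>\<^bsub>M\<^esub> m = \<zero>\<^bsub>M\<^esub>"
  shows "trace_ideal R M \<subseteq> {r \<in> carrier R. r \<otimes>\<^bsub>R\<^esub> a = \<zero>\<^bsub>R\<^esub>}"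
proof -
  interpret module R M by (rule M)
  have "f m \<in> {r \<in> carrier R. r \<otimes>\<^bsub>R\<^esub> a = \<zero>\<^bsub>R\<^esub>}"
    if f: "f \<in> mod_hom R M (self_module R)" and m: "m \<in> carrier M" for f m
  proof -
    have fm: "f m \<in> carrier R" "f \<zero>\<^bsub>M\<^esub> \<in> carrier R"
      using f m by (auto simp: mod_hom_def self_module_def)
    have "f (r \<odot>\<^bsub>M\<^esub> x) = r \<otimes>\<^bsub>R\<^esub> f x" if "r \<in> carrier R" "x \<in> carrier M" for r x
      using f that by (simp add: mod_hom_def self_module_def)
    from this[of "\<zero>\<^bsub>R\<^esub>" "\<zero>\<^bsub>M\<^esub>"] have "f \<zero>\<^bsub>M\<^esub> = \<zero>\<^bsub>R\<^esub>" using fm by simp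
    moreover have "f (a \<odot>\<^bsub>M\<^esub> m) = a \<otimes>\<^bsub>R\<^esub> f m"
      using f m a by (auto simp: mod_hom_def self_module_def)
    ultimately show ?thesis using fm a by (simp add: aM[OF m] R.m_comm)
  qed
  then show ?thesis
    unfolding trace_ideal_def by (intro R.genideal_minimal R.annihilator_ideal a) auto
qed

text \<open>The generators of \<open>tensor_rel\<close> have a name of their own so that those for a submodule can be
  compared with those for the ambient module.\<close>

definition tensor_relators ::
  "('r, 's) ring_scheme \<Rightarrow> ('r, 'm) module \<Rightarrow> ('r, 'b) module \<Rightarrow> (('m \<times> 'b) \<Rightarrow>\<^sub>0 int) set"
  where "tensor_relators R M B =
    {frag_of (m \<oplus>\<^bsub>M\<^esub> m', b) - frag_of (m, b) - frag_of (m', b) | m m' b.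
        m \<in> carrier M \<and> m' \<in> carrier M \<and> b \<in> carrier B} \<union>
     {frag_of (m, b \<oplus>\<^bsub>B\<^esub> b') - frag_of (m, b) - frag_of (m, b') | m b b'.
        m \<in> carrier M \<and> b \<in> carrier B \<and> b' \<in> carrier B} \<union>
     {frag_of (r \<odot>\<^bsub>M\<^esub> m, b) - frag_of (m, r \<odot>\<^bsub>B\<^esub> b) | r m b.
        r \<in> carrier R \<and> m \<in> carrier M \<and> b \<in> carrier B}"

lemma tensor_rel_eq_generate:
  "tensor_rel R M B = generate (tensor_free M B) (tensor_relators R M B)"
  by (simp add: tensor_rel_def tensor_relators_def)

lemma tensor_relators_mono:
  assumes "A \<subseteq> carrier B"
  shows "tensor_relators R M (B\<lparr>carrier := A\<rparr>) \<subseteq> tensor_relators R M B"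
  unfolding tensor_relators_def using assms by (intro Un_mono) (simp; blast)+

lemma tensor_relators_in_carrier:
  assumes M: "module R M" and B: "module R B"
  shows "tensor_relators R M B \<subseteq> carrier (tensor_free M B)"
proof -
  interpret M: module R M by (rule M)
  interpret B: module R B by (rule B)
  interpret G: group "tensor_free M B" by (simp add: tensor_free_def)
  have minus: "u - v \<in> carrier (tensor_free M B)"
    if "u \<in> carrier (tensor_free M B)" "v \<in> carrier (tensor_free M B)" for u v
    using that keys_diff[of u v] by (auto simp: tensor_free_def)
  have of: "frag_of (m, b) \<in> carrier (tensor_free M B)" if "m \<in> carrier M" "b \<in> carrier B" for m b
    using that by (simp only: tensor_free_def frag_of_in_free_Abelian_group) simp
  show ?thesis
    unfolding tensor_relators_def
    by (auto intro!: minus of simp del: carrier_free_Abelian_group_iff)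
qed

lemma tensor_rel_subgroup:
  assumes "module R M" and "module R B"
  shows "subgroup (tensor_rel R M B) (tensor_free M B)"
proof -
  interpret G: group "tensor_free M B" by (simp add: tensor_free_def)
  show ?thesis
    unfolding tensor_rel_eq_generate by (rule G.generate_is_subgroup[OF tensor_relators_in_carrier[OF assms]])
qed

text \<open>This is the computation \<open>m \<otimes> a u = a m \<otimes> u = 0 \<otimes> u = 0\<close>, carried out in the free abelian group.\<close>

lemma annihilated_tensor_in_rel:
  assumes M: "module R M" and B: "module R B" and a: "a \<in> carrier R"
    and aM: "\<And>m. m \<in> carrier M \<Longrightarrow> a \<odot>\<^bsub>M\<^esub> m = \<zero>\<^bsub>M\<^esub>"
    and m: "m \<in> carrier M" and u: "u \<in> carrier B"
  shows "frag_of (m, a \<odot>\<^bsub>B\<^esub> u) \<in> tensor_rel R M B"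
proof -
  interpret M: module R M by (rule M)
  interpret B: module R B by (rule B)
  interpret G: group "tensor_free M B" by (simp add: tensor_free_def)
  interpret rel: subgroup "tensor_rel R M B" "tensor_free M B"
    by (rule tensor_rel_subgroup[OF M B])
  have minus: "v - w \<in> tensor_rel R M B"
    if v: "v \<in> tensor_rel R M B" and w: "w \<in> tensor_rel R M B" for v w
  proof -
    have "v \<otimes>\<^bsub>tensor_free M B\<^esub> inv\<^bsub>tensor_free M B\<^esub> w \<in> tensor_rel R M B" using v w by simp
    moreover have "w \<in> carrier (tensor_free M B)" using w by (rule rel.mem_carrier)
    ultimately show ?thesis by (simp add: tensor_free_def)
  qed
  have zero: "0 \<in> tensor_rel R M B" using rel.one_closed by (simp add: tensor_free_def)
  \<comment> \<open>\<open>0 \<otimes> u\<close> vanishes because additivity in the first argument equates it with twice itself.\<close>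
  have "frag_of (\<zero>\<^bsub>M\<^esub> \<oplus>\<^bsub>M\<^esub> \<zero>\<^bsub>M\<^esub>, u) - frag_of (\<zero>\<^bsub>M\<^esub>, u) - frag_of (\<zero>\<^bsub>M\<^esub>, u) \<in> tensor_rel R M B"
    unfolding tensor_rel_def by (rule generate.incl) (use u in blast)
  from minus[OF zero this] have "frag_of (\<zero>\<^bsub>M\<^esub>, u) \<in> tensor_rel R M B" by simp
  moreover have "frag_of (a \<odot>\<^bsub>M\<^esub> m, u) - frag_of (m, a \<odot>\<^bsub>B\<^esub> u) \<in> tensor_rel R M B"
    unfolding tensor_rel_def by (rule generate.incl) (use a m u in blast)
  ultimately show ?thesis using minus[of "frag_of (\<zero>\<^bsub>M\<^esub>, u)"] by (fastforce simp: aM[OF m])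
qed

text \<open>This is what makes \<open>tensor_incl\<close> well defined. The two subgroups are generated inside different
  free abelian groups, so generators, inverses and products are compared one by one.\<close>

lemma tensor_rel_mono:
  assumes M: "module R M" and B: "module R B" and A: "submodule A R B"
  shows "tensor_rel R M (B\<lparr>carrier := A\<rparr>) \<subseteq> tensor_rel R M B"
proof
  have AB: "A \<subseteq> carrier B"
    using submodule.axioms(1)[OF A, THEN subgroup.subset] by simp
  let ?A = "B\<lparr>carrier := A\<rparr>"
  note SA = tensor_relators_in_carrier[OF M submodule.submodule_is_module[OF A B]]
  interpret rel: subgroup "tensor_rel R M B" "tensor_free M B"
    by (rule tensor_rel_subgroup[OF M B])
  fix z assume "z \<in> tensor_rel R M ?A"
  then show "z \<in> tensor_rel R M B"
    unfolding tensor_rel_eq_generate[of R M ?A]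
  proof (induction rule: generate.induct)
    case one
    then show ?case using rel.one_closed by (simp add: tensor_free_def)
  next
    case (incl h)
    then show ?case
      unfolding tensor_rel_eq_generate[of R M B]
      using tensor_relators_mono[OF AB] by (blast intro: generate.incl)
  next
    case (inv h)
    have "h \<in> tensor_rel R M B"
      unfolding tensor_rel_eq_generate[of R M B]
      using inv tensor_relators_mono[OF AB] by (blast intro: generate.incl)
    then have "inv\<^bsub>tensor_free M B\<^esub> h \<in> tensor_rel R M B" "h \<in> carrier (tensor_free M B)"
      by (auto intro: rel.mem_carrier)
    moreover have "h \<in> carrier (tensor_free M ?A)" using SA inv by (rule subsetD)
    ultimately show ?case by (simp add: tensor_free_def)
  next
    case (eng h1 h2)
    then show ?case using rel.m_closed by (simp add: tensor_free_def)
  qed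
qed

text \<open>The class of \<open>m \<otimes> a u\<close> in \<open>M \<otimes> B\<close> is zero, hence it is the image of the zero of \<open>M \<otimes> A\<close>,
  whatever \<open>A\<close> is.\<close>

lemma annihilated_in_closure:
  assumes M: "module R M" and B: "module R B" and A: "submodule A R B" and a: "a \<in> carrier R"
    and aM: "\<And>m. m \<in> carrier M \<Longrightarrow> a \<odot>\<^bsub>M\<^esub> m = \<zero>\<^bsub>M\<^esub>"
    and u: "u \<in> carrier B"
  shows "a \<odot>\<^bsub>B\<^esub> u \<in> mod_closure R M B A"
  unfolding mod_closure_def
proof (intro CollectI conjI ballI)
  interpret M: module R M by (rule M)
  interpret B: module R B by (rule B)
  show "a \<odot>\<^bsub>B\<^esub> u \<in> carrier B" using a u by simp
  fix m assume m: "m \<in> carrier M"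
  let ?A = "B\<lparr>carrier := A\<rparr>"
  let ?rA = "tensor_rel R M ?A" and ?rB = "tensor_rel R M B"
  interpret G: group "tensor_free M B" by (simp add: tensor_free_def)
  interpret GA: group "tensor_free M ?A" by (simp add: tensor_free_def)
  have sB: "subgroup ?rB (tensor_free M B)" by (rule tensor_rel_subgroup[OF M B])
  have sA: "subgroup ?rA (tensor_free M ?A)"
    by (rule tensor_rel_subgroup[OF M submodule.submodule_is_module[OF A B]])
  have "pure_tensor R M B m (a \<odot>\<^bsub>B\<^esub> u) = ?rB"
    unfolding pure_tensor_def
    using annihilated_tensor_in_rel[OF M B a aM m u] subgroup.mem_carrier[OF sB] sB
    by (intro G.coset_join2) auto
  also have "\<dots> = tensor_incl R M B ?rA"
  proof
    show "?rB \<subseteq> tensor_incl R M B ?rA"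
    proof
      fix z assume "z \<in> ?rB"
      moreover have "0 \<in> ?rA" using subgroup.one_closed[OF sA] by (simp add: tensor_free_def)
      ultimately show "z \<in> tensor_incl R M B ?rA"
        unfolding tensor_incl_def set_mult_def
        by (intro UN_I[of z] UN_I[of 0]) (simp_all add: tensor_free_def)
    qed
    show "tensor_incl R M B ?rA \<subseteq> ?rB"
      unfolding tensor_incl_def set_mult_def
      using tensor_rel_mono[OF M B A] subgroup.m_closed[OF sB] by auto
  qed
  finally show "pure_tensor R M B m (a \<odot>\<^bsub>B\<^esub> u) \<in> tensor_incl R M B ` carrier (tensor R M ?A)"
    using subgroup.subgroup_in_rcosets[OF sA GA.group_axioms]
    by (auto simp: tensor_def FactGroup_def)
qed

lemma (in cring) self_module_is_module: "module R (self_module R)"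
proof (rule moduleI)
  show "cring R" by (rule is_cring)
  show "abelian_group (self_module R)"
    by (rule abelian_groupI) (auto simp: self_module_def a_ac intro: l_neg)
qed (auto simp: self_module_def l_distr r_distr m_assoc)

lemma gen_submodule_subset:
  assumes M: "module R M" and S: "S \<subseteq> carrier M"
  shows "gen_submodule R M S \<subseteq> carrier M"
proof -
  interpret module R M by (rule M)
  show ?thesis using S carrier_is_submodule unfolding gen_submodule_def by blast
qed

lemma fin_gen_cyclic:
  assumes M: "module R M" and e: "e \<in> carrier M" and gen: "carrier M \<subseteq> (\<lambda>r. r \<odot>\<^bsub>M\<^esub> e) ` carrier R"
  shows "fin_gen R M"
proof -
  have "carrier M \<subseteq> gen_submodule R M {e}"
    using gen unfolding gen_submodule_def by (auto intro: submodule.smult_closed)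
  then have "gen_submodule R M {e} = carrier M" using gen_submodule_subset[OF M, of "{e}"] e by blast
  then show ?thesis unfolding fin_gen_def using e by (intro exI[of _ "{e}"]) auto
qed

text \<open>The pair \<open>0 \<subseteq> R\<close> suffices: the closure of \<open>0\<close> contains \<open>a = a 1\<close>, so that a colon element \<open>r\<close>
  satisfies \<open>r a = 0\<close>. Since \<open>test_ideal\<close> ranges over ambient modules whose carrier is a set in the
  type \<open>'r module_univ\<close>, an isomorphic copy of \<open>R\<close> is used, in which \<open>\<phi> 1\<close> plays the part of 1.\<close>

lemma test_ideal_annihilates:
  fixes R :: "('r, 's) ring_scheme" and M :: "('r, 'm) module"
  assumes M: "module R M" and a: "a \<in> carrier R"
    and aM: "\<And>m. m \<in> carrier M \<Longrightarrow> a \<odot>\<^bsub>M\<^esub> m = \<zero>\<^bsub>M\<^esub>"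
  shows "test_ideal R M \<subseteq> {r \<in> carrier R. r \<otimes>\<^bsub>R\<^esub> a = \<zero>\<^bsub>R\<^esub>}"
proof
  interpret module R M by (rule M)
  have self: "module R (self_module R)" by (rule R.self_module_is_module)
  have "fin_gen R (self_module R)"
    by (rule fin_gen_cyclic[OF self, of "\<one>\<^bsub>R\<^esub>"]) (force simp: self_module_def)+
  from fin_gen_module_in_univ[OF self this]
  obtain B :: "('r, 'r module_univ) module" and \<phi> where B: "module R B"
    and \<phi>: "\<phi> \<in> mod_hom R (self_module R) B"
    and bij: "bij_betw \<phi> (carrier (self_module R)) (carrier B)" by blast
  interpret B: module R B by (rule B)
  let ?u = "\<phi> \<one>\<^bsub>R\<^esub>"
  have u: "?u \<in> carrier B" using \<phi> by (auto simp: mod_hom_def self_module_def)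
  have \<phi>_smult: "\<phi> r = r \<odot>\<^bsub>B\<^esub> ?u" if "r \<in> carrier R" for r
  proof -
    have "\<forall>r\<in>carrier R. \<forall>x\<in>carrier R. \<phi> (r \<otimes>\<^bsub>R\<^esub> x) = r \<odot>\<^bsub>B\<^esub> \<phi> x"
      using \<phi> by (simp add: mod_hom_def self_module_def)
    then have "\<phi> (r \<otimes>\<^bsub>R\<^esub> \<one>\<^bsub>R\<^esub>) = r \<odot>\<^bsub>B\<^esub> ?u" using that by blast
    then show ?thesis using that by simp
  qed
  fix r assume "r \<in> test_ideal R M"
  then have "r \<in> colon_ideal R B {\<zero>\<^bsub>B\<^esub>} (mod_closure R M B {\<zero>\<^bsub>B\<^esub>})"
    unfolding test_ideal_def using B B.zero_submodule by blast
  moreover have "a \<odot>\<^bsub>B\<^esub> ?u \<in> mod_closure R M B {\<zero>\<^bsub>B\<^esub>}"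
    by (rule annihilated_in_closure[OF M B B.zero_submodule a aM u])
  ultimately have r: "r \<in> carrier R" and "r \<odot>\<^bsub>B\<^esub> (a \<odot>\<^bsub>B\<^esub> ?u) = \<zero>\<^bsub>B\<^esub>"
    by (auto simp: colon_ideal_def)
  then have "\<phi> (r \<otimes>\<^bsub>R\<^esub> a) = \<phi> \<zero>\<^bsub>R\<^esub>"
    using a u \<phi>_smult[of "r \<otimes>\<^bsub>R\<^esub> a"] \<phi>_smult[of "\<zero>\<^bsub>R\<^esub>"] by (simp add: B.smult_assoc1)
  moreover have "inj_on \<phi> (carrier R)" using bij by (simp add: bij_betw_def self_module_def)
  ultimately have "r \<otimes>\<^bsub>R\<^esub> a = \<zero>\<^bsub>R\<^esub>" using r a by (meson inj_onD R.m_closed R.zero_closed)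
  then show "r \<in> {r \<in> carrier R. r \<otimes>\<^bsub>R\<^esub> a = \<zero>\<^bsub>R\<^esub>}" using r by simp
qed

lemma (in cring) zero_in_trace_ideal: "\<zero> \<in> trace_ideal R M"
  by (auto simp: trace_ideal_def genideal_def additive_subgroup.zero_closed ideal.axioms(1))

lemma (in cring) zero_in_test_ideal: "\<zero> \<in> test_ideal R M"
proof -
  have "\<zero> \<odot>\<^bsub>B\<^esub> c \<in> A" if "module R B" "submodule A R B" "c \<in> mod_closure R M B A"
    for B :: "('a, 'a module_univ) module" and A c
  proof -
    have "c \<in> carrier B" using that by (simp add: mod_closure_def)
    then show ?thesis
      using that module.smult_l_null submodule.axioms(1) subgroup.one_closed by fastforce
  qed
  then show ?thesis unfolding test_ideal_def colon_ideal_def by auto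
qed

section \<open>Rings that map onto a power series ring in one variable\<close>

lemma fps_X_dvd_iff: "fps_X dvd (d :: 'k::field fps) \<longleftrightarrow> d $ 0 = 0"
proof
  assume "d $ 0 = 0"
  then have "d = fps_X * fps_shift 1 d" by (intro fps_ext) simp
  then show "fps_X dvd d" by (rule dvdI)
qed (auto elim!: dvdE)

lemma fps_dvd_one: "(d :: 'k::field fps) $ 0 \<noteq> 0 \<Longrightarrow> d dvd 1"
  by (metis dvdI inverse_mult_eq_1')

text \<open>The quotient of \<open>d\<close> by its highest power of \<open>X\<close> is a unit.\<close>

lemma fps_dvd_X_power:
  assumes "(d :: 'k::field fps) \<noteq> 0"
  shows "d dvd fps_X ^ subdegree d"
proof -
  have "fps_shift (subdegree d) d dvd 1" using assms by (intro fps_dvd_one) simp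
  then have "fps_X ^ subdegree d * fps_shift (subdegree d) d dvd fps_X ^ subdegree d * 1"
    by (intro mult_dvd_mono) auto
  then show ?thesis
    by (metis mult.commute mult_1_right subdegree_decompose)
qed

text \<open>Geometrically, \<open>h\<close> restricts functions on a curve with coordinate ring \<open>R\<close> to a smooth branch
  of the curve with parameter \<open>fps_X\<close>.\<close>

locale branch = cring R for R (structure) +
  fixes h :: "'a \<Rightarrow> 'k::field fps"
  assumes h_add [simp]: "\<lbrakk>r \<in> carrier R; s \<in> carrier R\<rbrakk> \<Longrightarrow> h (r \<oplus> s) = h r + h s"
    and h_mult [simp]: "\<lbrakk>r \<in> carrier R; s \<in> carrier R\<rbrakk> \<Longrightarrow> h (r \<otimes> s) = h r * h s"
    and h_one [simp]: "h \<one> = 1"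
    and h_surj: "h ` carrier R = UNIV"
begin

lemma h_zero [simp]: "h \<zero> = 0"
proof -
  have "h \<zero> = h \<zero> + h \<zero>" using h_add[of \<zero> \<zero>] by (simp del: h_add)
  then show ?thesis using add_cancel_left_left by metis
qed

lemma h_minus [simp]: "r \<in> carrier R \<Longrightarrow> h (\<ominus> r) = - h r"
  using h_add[of r "\<ominus> r"] by (simp add: r_neg eq_neg_iff_add_eq_0 add.commute)

lemma h_diff [simp]: "\<lbrakk>r \<in> carrier R; s \<in> carrier R\<rbrakk> \<Longrightarrow> h (r \<ominus> s) = h r - h s"
  by (simp add: a_minus_def)

lemma h_pow [simp]: "r \<in> carrier R \<Longrightarrow> h (r [^] (n::nat)) = h r ^ n"
  by (induction n) (simp_all add: mult.commute)

lemma lift: obtains r where "r \<in> carrier R" "h r = d"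
  using h_surj by (metis UNIV_I imageE)

abbreviation ker :: "'a set" where "ker \<equiv> {r \<in> carrier R. h r = 0}"

text \<open>The preimage of the maximal ideal of \<open>k\<lbrakk>t\<rbrakk>\<close>.\<close>

abbreviation maxid :: "'a set" where "maxid \<equiv> {r \<in> carrier R. h r $ 0 = 0}"

lemma ker_prime: "primeideal ker R"
proof (rule primeidealI)
  show "ideal ker R"
  proof (rule idealI)
    show "subgroup ker (add_monoid R)"
      by (rule subgroup.intro) (auto simp flip: a_inv_def)
  qed (auto intro: ring_axioms)
  show "cring R" by (rule is_cring)
  have "\<one> \<in> carrier R" "\<one> \<notin> ker" by simp_all
  then show "carrier R \<noteq> ker" by blast
qed auto

lemma maxid_prime: "primeideal maxid R"
proof (rule primeidealI)
  show "ideal maxid R"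
  proof (rule idealI)
    show "subgroup maxid (add_monoid R)"
      by (rule subgroup.intro) (auto simp flip: a_inv_def)
  qed (auto intro: ring_axioms)
  show "cring R" by (rule is_cring)
  have "\<one> \<in> carrier R" "\<one> \<notin> maxid" by simp_all
  then show "carrier R \<noteq> maxid" by blast
qed auto

text \<open>The chain consists of the preimages of the two primes \<open>0\<close> and \<open>(t)\<close> of \<open>k\<lbrakk>t\<rbrakk>\<close>.\<close>

lemma one_le_krull_dim: "1 \<le> krull_dim R"
proof -
  obtain t where t: "t \<in> carrier R" "h t = fps_X" by (rule lift)
  then have "t \<in> maxid" "t \<notin> ker" by simp_all
  then have "ker \<subset> maxid" by auto
  then have "\<exists>P. (\<forall>i\<le>1. primeideal (P i) R) \<and> (\<forall>i<1. P i \<subset> P (Suc i))"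
    using ker_prime maxid_prime
    by (intro exI[of _ "\<lambda>i::nat. if i = 0 then ker else maxid"]) auto
  then have "enat 1 \<le> krull_dim R" unfolding krull_dim_def by (intro Sup_upper) blast
  then show ?thesis by (simp add: one_enat_def)
qed

text \<open>A prime strictly above a prime over \<open>ker\<close> contains some \<open>f\<close> with \<open>h f \<noteq> 0\<close>. Up to a unit
  \<open>h f\<close> is \<open>t\<^sup>n\<close>, which divides \<open>(h s)\<^sup>n\<close> for every \<open>s\<close> in \<open>maxid\<close>. So \<open>s\<^sup>n\<close> is a multiple of
  \<open>f\<close> modulo \<open>ker\<close>, and primality yields \<open>s\<close>.\<close>

lemma maxid_subset_of_larger_prime:
  assumes Q: "primeideal Q R" and PQ: "P \<subset> Q" and P: "ker \<subseteq> P"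
  shows "maxid \<subseteq> Q"
proof
  interpret Q: primeideal Q R by (rule Q)
  fix s assume s: "s \<in> maxid"
  obtain f where f: "f \<in> Q" "f \<notin> P" using PQ by blast
  then have f': "f \<in> carrier R" "h f \<noteq> 0" using P Q.a_subset by blast+
  define n where "n = subdegree (h f)"
  have "h f dvd fps_X ^ n" unfolding n_def by (rule fps_dvd_X_power[OF f'(2)])
  also have "fps_X ^ n dvd h s ^ n" using s by (intro dvd_power_same) (simp add: fps_X_dvd_iff)
  finally obtain d where d: "h s ^ n = h f * d" by (rule dvdE)
  obtain w where w: "w \<in> carrier R" "h w = d" by (rule lift)
  have "s [^] n \<ominus> f \<otimes> w \<in> ker" using s f' w d by simp
  then have "s [^] n \<ominus> f \<otimes> w \<in> Q" using P PQ by blast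
  then have "(s [^] n \<ominus> f \<otimes> w) \<oplus> f \<otimes> w \<in> Q" using f w by (intro Q.a_closed Q.I_r_closed)
  then have "s [^] n \<in> Q" using s f' w by (simp add: a_minus_def a_assoc l_neg)
  then show "s \<in> Q"
  proof (induction n)
    case 0
    then show ?case using Q.one_imp_carrier s by auto
  next
    case (Suc n)
    then show ?case using s Q.I_prime[of "s [^] n" s] by auto
  qed
qed

text \<open>An element outside \<open>maxid\<close> has a unit as its image, hence is invertible modulo \<open>ker\<close>.\<close>

lemma maxid_maximal:
  assumes Q: "primeideal Q R" and le: "maxid \<subseteq> Q"
  shows "Q = maxid"
proof (rule ccontr)
  interpret Q: primeideal Q R by (rule Q)
  assume "Q \<noteq> maxid"
  then obtain r where r: "r \<in> Q" "r \<notin> maxid" using le by blast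
  then have r': "r \<in> carrier R" "h r $ 0 \<noteq> 0" by auto
  obtain d where d: "1 = h r * d" using fps_dvd_one[OF r'(2)] by (rule dvdE)
  obtain w where w: "w \<in> carrier R" "h w = d" by (rule lift)
  have "h (\<one> \<ominus> r \<otimes> w) = 0" using r' w d by simp
  then have "\<one> \<ominus> r \<otimes> w \<in> Q" using r' w le by auto
  then have "(\<one> \<ominus> r \<otimes> w) \<oplus> r \<otimes> w \<in> Q" using r w by (intro Q.a_closed Q.I_r_closed)
  then have "\<one> \<in> Q" using r' w by (simp add: a_minus_def a_assoc l_neg)
  then show False using Q.one_imp_carrier Q.I_notcarr by blast
qed

lemma no_prime_chain_over_ker:
  assumes "primeideal Q R" and "primeideal Q' R" and "ker \<subseteq> P" and "P \<subset> Q"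
  shows "\<not> Q \<subset> Q'"
proof
  assume "Q \<subset> Q'"
  then have "Q = maxid" "Q' = maxid"
    using assms maxid_maximal maxid_subset_of_larger_prime[of _ P] by blast+
  then show False using \<open>Q \<subset> Q'\<close> by blast
qed

end

text \<open>If every prime contains the kernel of a surjection onto \<open>k\<lbrakk>t\<rbrakk>\<close>, then a chain of primes
  \<open>P\<^sub>0 \<subset> P\<^sub>1 \<subset> P\<^sub>2\<close> would be a chain over the kernel that \<open>P\<^sub>0\<close> contains.\<close>

lemma krull_dim_eq_one:
  fixes h :: "'a \<Rightarrow> 'k::field fps"
  assumes h: "branch R h"
    and cover: "\<And>P. primeideal P R \<Longrightarrow>
      \<exists>g :: 'a \<Rightarrow> 'k fps. branch R g \<and> {r \<in> carrier R. g r = 0} \<subseteq> P"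
  shows "krull_dim R = 1"
proof (rule antisym)
  have "n \<le> 1" if P: "\<And>i. i \<le> n \<Longrightarrow> primeideal (P i) R" "\<And>i. i < n \<Longrightarrow> P i \<subset> P (Suc i)"
    for n :: nat and P
  proof (rule ccontr)
    assume "\<not> n \<le> 1"
    then have n: "2 \<le> n" by simp
    obtain g :: "'a \<Rightarrow> 'k fps" where g: "branch R g" "{r \<in> carrier R. g r = 0} \<subseteq> P 0"
      using cover[OF P(1)[of 0]] by blast
    have "P 0 \<subset> P 1" "P 1 \<subset> P 2" using P(2)[of 0] P(2)[of 1] n by (simp_all add: numeral_2_eq_2)
    moreover have "primeideal (P 1) R" "primeideal (P 2) R" using P(1) n by simp_all
    ultimately show False using branch.no_prime_chain_over_ker[OF g(1) _ _ g(2)] by blast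
  qed
  then show "krull_dim R \<le> 1"
    unfolding krull_dim_def one_enat_def by (intro Sup_least) (simp, metis enat_ord_simps(1))
  show "1 \<le> krull_dim R" by (rule branch.one_le_krull_dim[OF h])
qed

section \<open>The power series ring in one variable as a maximal Cohen-Macaulay module\<close>

lemma seq_mult_Nil:
  assumes M: "module R M"
  shows "seq_mult R M [] = {\<zero>\<^bsub>M\<^esub>}"
proof
  interpret module R M by (rule M)
  show "seq_mult R M [] \<subseteq> {\<zero>\<^bsub>M\<^esub>}"
    unfolding seq_mult_def gen_submodule_def using zero_submodule by auto
  show "{\<zero>\<^bsub>M\<^esub>} \<subseteq> seq_mult R M []"
    unfolding seq_mult_def gen_submodule_def
    using submodule.axioms(1) subgroup.one_closed by fastforce
qed

lemma smult_in_seq_mult: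
  assumes "a \<in> set xs" and "m \<in> carrier M"
  shows "a \<odot>\<^bsub>M\<^esub> m \<in> seq_mult R M xs"
  unfolding seq_mult_def gen_submodule_def using assms by auto

lemma seq_mult_single:
  assumes M: "module R M" and a: "a \<in> carrier R"
  shows "seq_mult R M [a] = (\<lambda>m. a \<odot>\<^bsub>M\<^esub> m) ` carrier M"
proof
  interpret module R M by (rule M)
  show "seq_mult R M [a] \<subseteq> (\<lambda>m. a \<odot>\<^bsub>M\<^esub> m) ` carrier M"
    unfolding seq_mult_def gen_submodule_def using smult_image_submodule[OF a] by auto
  show "(\<lambda>m. a \<odot>\<^bsub>M\<^esub> m) ` carrier M \<subseteq> seq_mult R M [a]"
    by (auto intro: smult_in_seq_mult)
qed

lemma seq_mult_subset:
  assumes M: "module R M" and xs: "set xs \<subseteq> carrier R"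
  shows "seq_mult R M xs \<subseteq> carrier M"
  unfolding seq_mult_def
  by (rule gen_submodule_subset[OF M]) (use xs M in \<open>auto intro: module.smult_closed\<close>)

context branch
begin

text \<open>A module with a generator \<open>e\<close> whose annihilator is \<open>ker\<close> is the \<open>R\<close>-module \<open>k\<lbrakk>t\<rbrakk>\<close> up to
  isomorphism. This form passes to isomorphic copies, as is needed to place the module in the
  type \<open>'r module_univ\<close>.\<close>

context
  fixes N :: "('a, 'n) module" and e
  assumes N: "module R N" and e: "e \<in> carrier N"
    and gen: "carrier N = (\<lambda>r. r \<odot>\<^bsub>N\<^esub> e) ` carrier R"
    and ann: "\<And>r. r \<in> carrier R \<Longrightarrow> r \<odot>\<^bsub>N\<^esub> e = \<zero>\<^bsub>N\<^esub> \<longleftrightarrow> h r = 0"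
begin

interpretation N: module R N by (rule N)

lemma smult_gen_eq_iff:
  assumes "r \<in> carrier R" and "s \<in> carrier R"
  shows "r \<odot>\<^bsub>N\<^esub> e = s \<odot>\<^bsub>N\<^esub> e \<longleftrightarrow> h r = h s"
proof -
  have "r = (r \<ominus> s) \<oplus> s" using assms by (simp add: a_minus_def a_assoc l_neg)
  then have sum: "r \<odot>\<^bsub>N\<^esub> e = (r \<ominus> s) \<odot>\<^bsub>N\<^esub> e \<oplus>\<^bsub>N\<^esub> s \<odot>\<^bsub>N\<^esub> e"
    using assms e N.smult_l_distr[of "r \<ominus> s" s e] by simp
  have "r \<odot>\<^bsub>N\<^esub> e = s \<odot>\<^bsub>N\<^esub> e \<longleftrightarrow> (r \<ominus> s) \<odot>\<^bsub>N\<^esub> e = \<zero>\<^bsub>N\<^esub>"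
    unfolding sum using assms e by (intro N.M.add.r_cancel_one) simp_all
  then show ?thesis using assms ann[of "r \<ominus> s"] by simp
qed

lemma smult_smult_gen: "\<lbrakk>r \<in> carrier R; s \<in> carrier R\<rbrakk> \<Longrightarrow> r \<odot>\<^bsub>N\<^esub> (s \<odot>\<^bsub>N\<^esub> e) = (r \<otimes> s) \<odot>\<^bsub>N\<^esub> e"
  using e by (simp add: N.smult_assoc1)

lemma smult_gen_in_multiples_iff:
  assumes a: "a \<in> carrier R" and r: "r \<in> carrier R"
  shows "r \<odot>\<^bsub>N\<^esub> e \<in> (\<lambda>m. a \<odot>\<^bsub>N\<^esub> m) ` carrier N \<longleftrightarrow> h a dvd h r"
proof
  assume "r \<odot>\<^bsub>N\<^esub> e \<in> (\<lambda>m. a \<odot>\<^bsub>N\<^esub> m) ` carrier N"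
  then obtain s where s: "s \<in> carrier R" "r \<odot>\<^bsub>N\<^esub> e = a \<odot>\<^bsub>N\<^esub> (s \<odot>\<^bsub>N\<^esub> e)" using gen by auto
  then have "h r = h (a \<otimes> s)" using a r by (simp add: smult_smult_gen smult_gen_eq_iff)
  then show "h a dvd h r" using a s by simp
next
  assume "h a dvd h r"
  then obtain d where d: "h r = h a * d" by (rule dvdE)
  obtain s where s: "s \<in> carrier R" "h s = d" by (rule lift)
  have "r \<odot>\<^bsub>N\<^esub> e = a \<odot>\<^bsub>N\<^esub> (s \<odot>\<^bsub>N\<^esub> e)"
    using a r s d by (simp add: smult_smult_gen smult_gen_eq_iff)
  moreover have "s \<odot>\<^bsub>N\<^esub> e \<in> carrier N" using s e by simp
  ultimately show "r \<odot>\<^bsub>N\<^esub> e \<in> (\<lambda>m. a \<odot>\<^bsub>N\<^esub> m) ` carrier N" by blast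
qed

text \<open>A preimage of the parameter of \<open>k\<lbrakk>t\<rbrakk>\<close> is regular, because \<open>k\<lbrakk>t\<rbrakk>\<close> is a domain in which it is not a unit.\<close>

lemma ex_regular_seq: "\<exists>t. regular_seq R N [t]"
proof -
  obtain t where t: "t \<in> carrier R" "h t = fps_X" by (rule lift)
  have "\<one> \<odot>\<^bsub>N\<^esub> e \<notin> seq_mult R N [t]"
    using t by (simp add: seq_mult_single[OF N] smult_gen_in_multiples_iff fps_X_dvd_iff del: N.smult_one)
  then have "seq_mult R N [t] \<noteq> carrier N" using e by auto
  moreover have "m = \<zero>\<^bsub>N\<^esub>" if "m \<in> carrier N" "t \<odot>\<^bsub>N\<^esub> m = \<zero>\<^bsub>N\<^esub>" for m
    using that t by (auto simp: gen smult_smult_gen ann)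
  ultimately have "regular_seq R N [t]"
    unfolding regular_seq_def using t(1) by (simp add: seq_mult_Nil[OF N])
  then show ?thesis ..
qed

text \<open>Suppose that \<open>a, b\<close> begin a regular sequence. Properness forces both to have nonunit images
  \<open>t a'\<close> and \<open>t c\<close>. Then \<open>b\<close> times the element \<open>a'\<close> of \<open>k\<lbrakk>t\<rbrakk>\<close> is \<open>t c a'\<close>, a multiple of \<open>a\<close>,
  although \<open>a'\<close> is not one, so \<open>b\<close> is a zero divisor modulo \<open>a\<close>.\<close>

lemma regular_seq_length_le:
  assumes reg: "regular_seq R N xs"
  shows "length xs \<le> 1"
proof (rule ccontr)
  assume "\<not> length xs \<le> 1"
  then obtain a b ys where xs: "xs = a # b # ys"
    by (cases xs; cases "tl xs") auto
  have ab: "a \<in> carrier R" "b \<in> carrier R"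
    and proper: "seq_mult R N xs \<noteq> carrier N"
    using reg by (auto simp: regular_seq_def xs)
  have reg_i: "m \<in> seq_mult R N (take i xs)"
    if "i < length xs" "m \<in> carrier N" "(xs ! i) \<odot>\<^bsub>N\<^esub> m \<in> seq_mult R N (take i xs)" for i m
    using reg that unfolding regular_seq_def by blast
  have nonunit: "fps_X dvd h c" if c: "c \<in> set xs" "c \<in> carrier R" for c
  proof (rule ccontr)
    assume "\<not> fps_X dvd h c"
    then have "h c dvd 1" by (intro fps_dvd_one) (simp add: fps_X_dvd_iff)
    have "carrier N \<subseteq> seq_mult R N xs"
    proof
      fix m assume m: "m \<in> carrier N"
      obtain r where r: "r \<in> carrier R" "m = r \<odot>\<^bsub>N\<^esub> e" using m gen by blast
      have "h c dvd h r" using \<open>h c dvd 1\<close> by (rule dvd_trans) simp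
      then have "m \<in> (\<lambda>m. c \<odot>\<^bsub>N\<^esub> m) ` carrier N"
        using smult_gen_in_multiples_iff[OF c(2) r(1)] r(2) by simp
      then show "m \<in> seq_mult R N xs" by (auto intro: smult_in_seq_mult c(1))
    qed
    then show False using proper seq_mult_subset[OF N, of xs] reg by (auto simp: regular_seq_def)
  qed
  obtain a' where a': "h a = fps_X * a'" using nonunit[of a] ab by (auto simp: xs elim: dvdE)
  obtain c where c: "h b = fps_X * c" using nonunit[of b] ab by (auto simp: xs elim: dvdE)
  \<comment> \<open>Otherwise \<open>a\<close> kills the generator and is not regular.\<close>
  have "h a \<noteq> 0"
  proof
    assume "h a = 0"
    then have "e = \<zero>\<^bsub>N\<^esub>" using reg_i[of 0 e] ann[of a] ab e by (simp add: xs seq_mult_Nil[OF N])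
    then show False using ann[of \<one>] e by simp
  qed
  obtain w where w: "w \<in> carrier R" "h w = a'" by (rule lift)
  have "h (b \<otimes> w) = h a * c" using ab w a' c by simp
  then have "(b \<otimes> w) \<odot>\<^bsub>N\<^esub> e \<in> seq_mult R N [a]"
    using ab w by (simp add: seq_mult_single[OF N] smult_gen_in_multiples_iff)
  then have "b \<odot>\<^bsub>N\<^esub> (w \<odot>\<^bsub>N\<^esub> e) \<in> seq_mult R N [a]" using ab w by (simp add: smult_smult_gen)
  then have "w \<odot>\<^bsub>N\<^esub> e \<in> seq_mult R N [a]" using reg_i[of 1 "w \<odot>\<^bsub>N\<^esub> e"] w e by (simp add: xs)
  then have "fps_X * a' dvd 1 * a'"
    using ab w a' by (simp add: seq_mult_single[OF N] smult_gen_in_multiples_iff)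
  then have "fps_X dvd (1 :: 'k fps)" using \<open>h a \<noteq> 0\<close> a' by (subst (asm) dvd_mult_cancel_right) auto
  then show False by (simp add: fps_X_dvd_iff)
qed

lemma module_depth_eq_one: "module_depth R N = 1"
proof (rule antisym)
  show "module_depth R N \<le> 1"
    unfolding module_depth_def using regular_seq_length_le
    by (intro Sup_least) (auto simp: one_enat_def)
  obtain t where "regular_seq R N [t]" using ex_regular_seq by blast
  then have "enat (length [t]) \<le> module_depth R N"
    unfolding module_depth_def by (intro Sup_upper) blast
  then show "1 \<le> module_depth R N" by (simp add: one_enat_def)
qed

end

text \<open>The module is \<open>k\<lbrakk>t\<rbrakk>\<close> with \<open>R\<close> acting through \<open>h\<close>, generated by 1 and moved into the type
  \<open>'r module_univ\<close> over which the intersections range.\<close>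

lemma ex_MCM_killed_by_ker:
  assumes dim: "krull_dim R = 1"
  shows "\<exists>N :: ('a, 'a module_univ) module. MCM R N \<and>
    (\<forall>a\<in>ker. \<forall>m\<in>carrier N. a \<odot>\<^bsub>N\<^esub> m = \<zero>\<^bsub>N\<^esub>)"
proof -
  define D :: "('a, 'k fps) module" where
    "D = \<lparr>carrier = UNIV, monoid.mult = (*), one = 1, ring.zero = 0, add = (+),
      module.smult = \<lambda>r d. h r * d\<rparr>"
  have D: "module R D"
  proof (rule moduleI)
    show "cring R" by (rule is_cring)
    show "abelian_group D"
      by (rule abelian_groupI) (auto simp: D_def algebra_simps intro: exI[of _ "- x" for x])
  qed (auto simp: D_def algebra_simps)
  have "fin_gen R D"
    by (rule fin_gen_cyclic[OF D, of 1]) (auto simp: D_def h_surj)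
  from fin_gen_module_in_univ[OF D this]
  obtain N :: "('a, 'a module_univ) module" and \<phi> where N: "module R N"
    and \<phi>: "\<phi> \<in> mod_hom R D N" and bij: "bij_betw \<phi> (carrier D) (carrier N)" by blast
  interpret N: module R N by (rule N)
  let ?e = "\<phi> 1"
  have e: "?e \<in> carrier N" using \<phi> by (auto simp: mod_hom_def D_def)
  have \<phi>_h: "\<phi> (h r) = r \<odot>\<^bsub>N\<^esub> ?e" if "r \<in> carrier R" for r
  proof -
    have "\<forall>r\<in>carrier R. \<forall>d. \<phi> (h r * d) = r \<odot>\<^bsub>N\<^esub> \<phi> d"
      using \<phi> by (simp add: mod_hom_def D_def)
    then have "\<phi> (h r * 1) = r \<odot>\<^bsub>N\<^esub> ?e" using that by blast
    then show ?thesis by simp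
  qed
  have gen: "carrier N = (\<lambda>r. r \<odot>\<^bsub>N\<^esub> ?e) ` carrier R"
  proof -
    have "carrier N = \<phi> ` h ` carrier R" using bij by (simp add: h_surj bij_betw_def D_def)
    also have "\<dots> = (\<lambda>r. r \<odot>\<^bsub>N\<^esub> ?e) ` carrier R" by (auto simp: \<phi>_h image_image)
    finally show ?thesis .
  qed
  have ann: "r \<odot>\<^bsub>N\<^esub> ?e = \<zero>\<^bsub>N\<^esub> \<longleftrightarrow> h r = 0" if r: "r \<in> carrier R" for r
  proof -
    have "\<phi> 0 = \<zero>\<^bsub>N\<^esub>" using \<phi>_h[of \<zero>] e by simp
    then have "r \<odot>\<^bsub>N\<^esub> ?e = \<zero>\<^bsub>N\<^esub> \<longleftrightarrow> \<phi> (h r) = \<phi> 0" using \<phi>_h[OF r] by simp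
    also have "\<dots> \<longleftrightarrow> h r = 0" using bij by (auto simp: bij_betw_def D_def dest: injD)
    finally show ?thesis .
  qed
  have "?e \<noteq> \<zero>\<^bsub>N\<^esub>" using ann[of \<one>] e by simp
  moreover have "fin_gen R N" by (rule fin_gen_cyclic[OF N e]) (simp add: gen)
  moreover have "module_depth R N = 1" by (rule module_depth_eq_one[OF N e gen ann])
  ultimately have "MCM R N" using N e dim by (auto simp: MCM_def)
  moreover have "a \<odot>\<^bsub>N\<^esub> m = \<zero>\<^bsub>N\<^esub>" if a: "a \<in> ker" and m: "m \<in> carrier N" for a m
  proof -
    obtain r where r: "r \<in> carrier R" "m = r \<odot>\<^bsub>N\<^esub> ?e" using m gen by auto
    then have "a \<odot>\<^bsub>N\<^esub> m = (a \<otimes> r) \<odot>\<^bsub>N\<^esub> ?e" using a e by (simp add: N.smult_assoc1)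
    also have "\<dots> = \<zero>\<^bsub>N\<^esub>" using a r by (subst ann) auto
    finally show ?thesis .
  qed
  ultimately show ?thesis by blast
qed

lemma tau_and_trace_MCM_annihilate_ker:
  assumes "krull_dim R = 1" and "a \<in> ker" and "r \<in> tau_MCM R \<or> r \<in> trace_MCM R"
  shows "r \<otimes> a = \<zero>"
proof -
  obtain N :: "('a, 'a module_univ) module"
    where N: "MCM R N" "\<And>m. m \<in> carrier N \<Longrightarrow> a \<odot>\<^bsub>N\<^esub> m = \<zero>\<^bsub>N\<^esub>"
    using ex_MCM_killed_by_ker assms by blast
  have mod: "module R N" using N(1) by (simp add: MCM_def)
  have a: "a \<in> carrier R" using assms(2) by simp
  have "r \<in> test_ideal R N \<or> r \<in> trace_ideal R N"
    using assms(3) N(1) by (auto simp: tau_MCM_def trace_MCM_def)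
  then show ?thesis
    using test_ideal_annihilates[OF mod a N(2)] trace_ideal_annihilates[OF mod a N(2)] by auto
qed

end

section \<open>The two components of the curve\<close>

text \<open>A surjection onto \<open>k\<lbrakk>t\<rbrakk>\<close> that vanishes on \<open>I\<close> is constant on the cosets of \<open>I\<close>, and
  \<open>the_elem\<close> reads off that constant.\<close>

lemma quotient_branch:
  fixes p :: "'a::comm_ring_1 \<Rightarrow> 'k::field fps"
  assumes I: "ideal I (ring_of_type_algebra :: 'a ring)"
    and p_add: "\<And>f g. p (f + g) = p f + p g" and p_mult: "\<And>f g. p (f * g) = p f * p g"
    and p_one: "p 1 = 1" and p_surj: "surj p" and p_I: "\<And>f. f \<in> I \<Longrightarrow> p f = 0"
  shows "the_elem (p ` (I +>\<^bsub>ring_of_type_algebra\<^esub> f)) = p f"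
    and "branch ((ring_of_type_algebra :: 'a ring) Quot I) (\<lambda>A. the_elem (p ` A))"
proof -
  let ?S = "ring_of_type_algebra :: 'a ring"
  interpret S: cring ?S by (rule cring_from_type_algebra)
  interpret I: ideal I ?S by (rule I)
  have "0 \<in> I" using I.zero_closed by (simp add: ring_of_type_algebra_def)
  have p_coset: "the_elem (p ` (I +>\<^bsub>?S\<^esub> f)) = p f" for f
  proof -
    have "I +>\<^bsub>?S\<^esub> f = (\<lambda>i. i + f) ` I"
      by (auto simp: a_r_coset_def' ring_of_type_algebra_def)
    then have "p ` (I +>\<^bsub>?S\<^esub> f) = {p f}" using \<open>0 \<in> I\<close> by (auto simp: image_image p_add p_I)
    then show ?thesis by simp
  qed
  show "the_elem (p ` (I +>\<^bsub>?S\<^esub> f)) = p f" by (rule p_coset)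
  have hom: "(\<lambda>f. I +>\<^bsub>?S\<^esub> f) \<in> ring_hom ?S (?S Quot I)" by (rule I.rcos_ring_hom)
  have sum: "(I +>\<^bsub>?S\<^esub> f) \<oplus>\<^bsub>?S Quot I\<^esub> (I +>\<^bsub>?S\<^esub> g) = I +>\<^bsub>?S\<^esub> (f + g)" for f g
    using ring_hom_add[OF hom, of f g] by (simp add: ring_of_type_algebra_def)
  have prod: "(I +>\<^bsub>?S\<^esub> f) \<otimes>\<^bsub>?S Quot I\<^esub> (I +>\<^bsub>?S\<^esub> g) = I +>\<^bsub>?S\<^esub> (f * g)" for f g
    using ring_hom_mult[OF hom, of f g] by (simp add: ring_of_type_algebra_def)
  have unit: "\<one>\<^bsub>?S Quot I\<^esub> = I +>\<^bsub>?S\<^esub> 1"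
    using ring_hom_one[OF hom] by (simp add: ring_of_type_algebra_def)
  have carr: "carrier (?S Quot I) = range (\<lambda>f. I +>\<^bsub>?S\<^esub> f)"
    by (auto simp: FactRing_def A_RCOSETS_def' ring_of_type_algebra_def)
  interpret Q: cring "?S Quot I" by (rule I.quotient_is_cring) (rule S.is_cring)
  show "branch (?S Quot I) (\<lambda>A. the_elem (p ` A))"
  proof unfold_locales
    show "(\<lambda>A. the_elem (p ` A)) ` carrier (?S Quot I) = UNIV"
      using p_surj by (auto simp: carr p_coset image_image)
  qed (auto simp: carr sum prod unit p_coset p_add p_mult p_one)
qed

text \<open>Setting \<open>x = 0\<close> takes the constant term of each coefficient, since \<open>x\<close> is the inner variable;
  setting \<open>y = 0\<close> takes the constant coefficient, a power series in \<open>x\<close>.\<close>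

definition mod_X :: "'k::field fps fps \<Rightarrow> 'k fps"
  where "mod_X f = Abs_fps (\<lambda>n. f $ n $ 0)"

definition mod_Y :: "'k::field fps fps \<Rightarrow> 'k fps"
  where "mod_Y f = f $ 0"

lemma mod_X_hom: "mod_X (f + g) = mod_X f + mod_X g" "mod_X (f * g) = mod_X f * mod_X g"
  "mod_X 1 = 1" "surj mod_X"
proof -
  show "surj mod_X"
    by (rule surjI[of _ "\<lambda>d. Abs_fps (\<lambda>n. fps_const (d $ n))"]) (simp add: mod_X_def fps_eq_iff)
qed (auto simp: mod_X_def fps_eq_iff fps_mult_nth fps_sum_nth)

lemma mod_Y_hom: "mod_Y (f + g) = mod_Y f + mod_Y g" "mod_Y (f * g) = mod_Y f * mod_Y g"
  "mod_Y 1 = 1" "surj mod_Y"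
proof -
  show "surj mod_Y"
    by (rule surjI[of _ fps_const]) (simp add: mod_Y_def)
qed (auto simp: mod_Y_def fps_mult_nth)

lemma mod_X_eq_0_iff: "mod_X f = 0 \<longleftrightarrow> X_var dvd f"
proof
  assume "mod_X f = 0"
  then have "f $ n $ 0 = 0" for n by (simp add: mod_X_def fps_eq_iff)
  then have "f = X_var * Abs_fps (\<lambda>n. fps_shift 1 (f $ n))"
    by (auto simp: X_var_def fps_eq_iff)
  then show "X_var dvd f" by (rule dvdI)
qed (auto simp: X_var_def mod_X_def fps_eq_iff elim!: dvdE)

lemma mod_Y_eq_0_iff: "mod_Y f = 0 \<longleftrightarrow> Y_var dvd f"
proof
  assume "mod_Y f = 0"
  then have "f = Y_var * fps_shift 1 f" by (intro fps_ext) (auto simp: mod_Y_def Y_var_def)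
  then show "Y_var dvd f" by (rule dvdI)
qed (auto simp: Y_var_def mod_Y_def elim!: dvdE)

text \<open>In terms of the quotient ring, its socle is zero. Cancelling \<open>y\<close> gives \<open>f = x\<^sup>2 g\<close>, cancelling \<open>x\<close>
  gives \<open>y | f\<close>, and \<open>y\<close> divides \<open>g\<close> because \<open>k\<lbrakk>x, y\<rbrakk>/(y) = k\<lbrakk>x\<rbrakk>\<close> is a domain in which \<open>x\<close> is
  not zero.\<close>

lemma X2Y_dvd_if_dvd_mult_vars:
  fixes f :: "'k::field fps fps"
  assumes x: "X_var\<^sup>2 * Y_var dvd f * X_var" and y: "X_var\<^sup>2 * Y_var dvd f * Y_var"
  shows "X_var\<^sup>2 * Y_var dvd f"
proof -
  have nz: "(X_var :: 'k fps fps) \<noteq> 0" "(Y_var :: 'k fps fps) \<noteq> 0"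
    by (auto simp: X_var_def Y_var_def)
  have "(X_var * Y_var) * X_var dvd f * X_var" using x by (simp add: power2_eq_square ac_simps)
  then have "Y_var dvd f" using nz by (auto dest: dvd_mult_right)
  moreover obtain g where g: "f = X_var\<^sup>2 * g" using y nz by (auto elim: dvdE)
  ultimately have "mod_Y (X_var\<^sup>2 * g) = 0" by (simp add: mod_Y_eq_0_iff)
  then have "mod_Y X_var ^ 2 * mod_Y g = 0" by (simp add: mod_Y_hom power2_eq_square)
  moreover have "mod_Y X_var \<noteq> (0 :: 'k fps)" by (simp add: mod_Y_def X_var_def)
  ultimately have "Y_var dvd g" by (simp add: mod_Y_eq_0_iff)
  then show ?thesis by (simp add: g mult_dvd_mono)
qed

theorem proposition5p2:
  fixes R :: "('k::field) fps fps set ring"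
  assumes "R = fps2_ring Quot (genideal fps2_ring {X_var ^ 2 * Y_var})"
  shows "tau_MCM R = {\<zero>\<^bsub>R\<^esub>} \<and> trace_MCM R = {\<zero>\<^bsub>R\<^esub>}"
proof -
  let ?S = "ring_of_type_algebra :: 'k fps fps ring"
  interpret S: cring ?S by (rule cring_from_type_algebra)
  define I where "I = genideal ?S {X_var ^ 2 * Y_var}"
  have I: "ideal I ?S" unfolding I_def by (rule S.genideal_ideal) (simp add: ring_of_type_algebra_def)
  interpret I: ideal I ?S by (rule I)
  have I_iff: "f \<in> I \<longleftrightarrow> X_var ^ 2 * Y_var dvd f" for f
  proof -
    have "I = PIdl\<^bsub>?S\<^esub> (X_var ^ 2 * Y_var)"
      unfolding I_def by (rule S.cgenideal_eq_genideal[symmetric]) (simp add: ring_of_type_algebra_def)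
    then show ?thesis
      by (auto simp: cgenideal_def ring_of_type_algebra_def dvd_def mult.commute)
  qed
  have R: "R = ?S Quot I" using assms by (simp add: I_def fps2_ring_def)
  define q where "q = (\<lambda>f. I +>\<^bsub>?S\<^esub> f)"
  have hom: "q \<in> ring_hom ?S R" unfolding q_def R by (rule I.rcos_ring_hom)
  have q_mult: "q f \<otimes>\<^bsub>R\<^esub> q g = q (f * g)" for f g
    using ring_hom_mult[OF hom, of f g] by (simp add: ring_of_type_algebra_def)
  have carr: "carrier R = range q"
    by (auto simp: R q_def FactRing_def A_RCOSETS_def' ring_of_type_algebra_def)
  have q_zero: "q f = \<zero>\<^bsub>R\<^esub> \<longleftrightarrow> X_var ^ 2 * Y_var dvd f" for f
  proof -
    have "q f = I \<longleftrightarrow> f \<in> I"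
      unfolding q_def using I.a_rcos_const I.a_rcos_self
      by (auto simp: ring_of_type_algebra_def)
    then show ?thesis by (simp add: R FactRing_def I_iff)
  qed
  have R_cring: "cring R" unfolding R by (rule I.quotient_is_cring) (rule S.is_cring)
  interpret R: cring R by (rule R_cring)

  define hx where "hx = (\<lambda>A :: 'k fps fps set. the_elem (mod_X ` A))"
  define hy where "hy = (\<lambda>A :: 'k fps fps set. the_elem (mod_Y ` A))"
  have vanish: "mod_X f = 0" "mod_Y f = 0" if "f \<in> I" for f
    using that by (auto simp: I_iff mod_X_eq_0_iff mod_Y_eq_0_iff power2_eq_square mult.assoc
        dest: dvd_mult_left dvd_mult_right)
  have hx: "branch R hx" and hx_q: "hx (q f) = mod_X f" for f
    unfolding hx_def R q_def using quotient_branch[OF I mod_X_hom vanish(1)] by auto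
  have hy: "branch R hy" and hy_q: "hy (q f) = mod_Y f" for f
    unfolding hy_def R q_def using quotient_branch[OF I mod_Y_hom vanish(2)] by auto
  have dim: "krull_dim R = 1"
  proof (rule krull_dim_eq_one[OF hx])
    fix P assume "primeideal P R"
    then interpret P: primeideal P R .
    have qc: "q f \<in> carrier R" for f by (simp add: carr)
    have multiples: "{r \<in> carrier R. g r = 0} \<subseteq> P"
      if v: "q v \<in> P" and ker: "\<And>f. g (q f) = 0 \<Longrightarrow> v dvd f" for g :: "_ \<Rightarrow> 'k fps" and v
    proof
      fix r assume "r \<in> {r \<in> carrier R. g r = 0}"
      then obtain f where f: "r = q f" "g (q f) = 0" by (auto simp: carr)
      then obtain w where "f = v * w" using ker by (meson dvdE)
      then show "r \<in> P" using P.I_r_closed[OF v qc[of w]] f by (simp add: q_mult)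
    qed
    \<comment> \<open>A prime contains \<open>x\<close> or \<open>y\<close> since \<open>x (x y) = 0\<close>, hence one of the two kernels.\<close>
    have "q X_var \<otimes>\<^bsub>R\<^esub> (q X_var \<otimes>\<^bsub>R\<^esub> q Y_var) = \<zero>\<^bsub>R\<^esub>"
      by (simp add: q_mult q_zero power2_eq_square mult.assoc)
    then have "q X_var \<otimes>\<^bsub>R\<^esub> (q X_var \<otimes>\<^bsub>R\<^esub> q Y_var) \<in> P" by simp
    then have "q X_var \<in> P \<or> q Y_var \<in> P" using P.I_prime qc R.m_closed by meson
    then show "\<exists>g. branch R g \<and> {r \<in> carrier R. g r = (0 :: 'k fps)} \<subseteq> P"
    proof
      assume "q X_var \<in> P"
      then show ?thesis using hx multiples[of X_var hx] by (auto simp: hx_q mod_X_eq_0_iff)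
    next
      assume "q Y_var \<in> P"
      then show ?thesis using hy multiples[of Y_var hy] by (auto simp: hy_q mod_Y_eq_0_iff)
    qed
  qed
  have zero: "r = \<zero>\<^bsub>R\<^esub>" if r: "r \<in> tau_MCM R \<or> r \<in> trace_MCM R" for r
  proof -
    have "r \<in> carrier R" using r by (auto simp: tau_MCM_def trace_MCM_def)
    then obtain f where f: "r = q f" by (auto simp: carr)
    have x: "r \<otimes>\<^bsub>R\<^esub> q X_var = \<zero>\<^bsub>R\<^esub>"
      by (rule branch.tau_and_trace_MCM_annihilate_ker[OF hx dim _ r])
        (simp add: carr hx_q mod_X_eq_0_iff)
    have y: "r \<otimes>\<^bsub>R\<^esub> q Y_var = \<zero>\<^bsub>R\<^esub>"
      by (rule branch.tau_and_trace_MCM_annihilate_ker[OF hy dim _ r])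
        (simp add: carr hy_q mod_Y_eq_0_iff)
    have "X_var\<^sup>2 * Y_var dvd f"
      using x y unfolding f q_mult q_zero by (rule X2Y_dvd_if_dvd_mult_vars)
    then show ?thesis unfolding f q_zero .
  qed
  have "\<zero>\<^bsub>R\<^esub> \<in> tau_MCM R" "\<zero>\<^bsub>R\<^esub> \<in> trace_MCM R"
    by (auto simp: tau_MCM_def trace_MCM_def R.zero_in_test_ideal R.zero_in_trace_ideal)
  then show ?thesis using zero by blast
qed

end
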